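(* For $a\in\mathbb{R}$ let $(R_n)_{n\geq 1}$ be the sequence of polynomials defined by $R_1(x)=x$ and, for $n\geq 1$, $R_{n+1}(x)=xR_n(x)-\frac{a}{n}(1-x^2)R_n'(x)$. Then: (1) for all $a\in\mathbb{R}$ and $n\geq 1$, $R_n$ is odd (resp. even) for odd (resp. even) values of $n$, and $R_n(1)=1$ and $R_n(-1)=(-1)^n$; (2) for $a\in\mathbb{R}\setminus\{-1\}$ and $n\geq 1$, the polynomial $R_n$ has degree $n$ and dominant coefficient $(a+1)^{n-1}$; (3) for $a=0$ and $n\geq 1$, $R_n(x)=x^n$; (4) for $a=1$ and $n\geq 1$, $R_n(x)$ is the $n$th Chebyshev polynomial of the first kind; (5) for $a=-1$, $R_1(x)=x$ and, for $n\geq 2$, $R_n$ has degree $n-2$, with dominant coefficient $\frac{2^{n-2}}{(n-1)!}$; (6) when $a>0$, the coefficients of $R_n$ have alternating signs, and when $a\in[-1,0]$ the coefficients of $R_n$ are nonnegative; (7) viewed as a polynomial in $a$, $R_n$ has degree $n-1$.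
   Context: The $n$th Chebyshev polynomial of the first kind is the polynomial $T_n$ such that $T_n(\cos t)=\cos(nt)$ for all real $t$. The dominant coefficient of a polynomial in $x$ is the coefficient of its highest-degree term. "The coefficients have alternating signs" refers to the coefficients of $x^n,x^{n-2},x^{n-4},\dots$ (the other coefficients vanish by parity): the signs of consecutive coefficients in this list alternate. *)

theory Defs
  imports Complex_Main "HOL-Computational_Algebra.Polynomial"
begin

text \<open>The sequence starts at index 1; no equation is given for index 0. The last equation
  is stated for index \<open>n + 1\<close> with \<open>n = Suc m \<ge> 1\<close>; \<open>Rpoly_rec\<close> below gives it in terms of \<open>n\<close>.\<close>

fun Rpoly :: "real \<Rightarrow> nat \<Rightarrow> real poly" where
  "Rpoly a (Suc 0) = [:0, 1:]"
| "Rpoly a (Suc (Suc m)) =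
     [:0, 1:] * Rpoly a (Suc m) - smult (a / real (Suc m)) ([:1, 0, -1:] * pderiv (Rpoly a (Suc m)))"

lemma Rpoly_rec:
  assumes "n \<ge> 1"
  shows "Rpoly a (n + 1) =
    [:0, 1:] * Rpoly a n - smult (a / real n) ((1 - [:0, 1:]\<^sup>2) * pderiv (Rpoly a n))"
proof -
  obtain m where "n = Suc m" using assms by (cases n) auto
  moreover have "(1 - [:0, 1:]\<^sup>2 :: real poly) = [:1, 0, -1:]"
    by (simp add: power2_eq_square one_pCons)
  ultimately show ?thesis by simp
qed

definition chebyshev_T :: "nat \<Rightarrow> real poly" where
  "chebyshev_T n = (THE p. \<forall>t::real. poly p (cos t) = cos (real n * t))"

lemma chebyshev_T_unique_existence: "\<exists>!p. \<forall>t::real. poly p (cos t) = cos (real n * t)"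
proof (rule ex_ex1I)
  show "\<exists>p. \<forall>t::real. poly p (cos t) = cos (real n * t)"
  proof (induction n rule: less_induct)
    case (less n)
    consider "n = 0" | "n = 1" | m where "n = Suc (Suc m)"
      by (metis One_nat_def not0_implies_Suc)
    then show ?case
    proof cases
      case 1 then show ?thesis by (intro exI[of _ 1]) simp
    next
      case 2 then show ?thesis by (intro exI[of _ "[:0, 1:]"]) simp
    next
      case 3
      obtain p q where p: "\<forall>t::real. poly p (cos t) = cos (real m * t)"
        and q: "\<forall>t::real. poly q (cos t) = cos (real (Suc m) * t)"
        using less[of m] less[of "Suc m"] 3 by auto
      have "cos (real n * t) = 2 * cos t * cos (real (Suc m) * t) - cos (real m * t)" for t :: real
      proof -
        have "cos (real n * t) = cos (real (Suc m) * t + t)"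
          and "cos (real m * t) = cos (real (Suc m) * t - t)"
          using 3 by (simp_all add: algebra_simps)
        then show ?thesis unfolding cos_add cos_diff by simp
      qed
      then show ?thesis using p q by (intro exI[of _ "[:0, 2:] * q - p"]) (simp add: algebra_simps)
    qed
  qed
next
  fix p q :: "real poly"
  assume p: "\<forall>t. poly p (cos t) = cos (real n * t)" and q: "\<forall>t. poly q (cos t) = cos (real n * t)"
  have "{-1..1} \<subseteq> {x. poly (p - q) x = 0}"
  proof
    fix x :: real assume "x \<in> {-1..1}"
    then have "x = cos (arccos x)" by simp
    then have "poly p x = poly q x" using p q by metis
    then show "x \<in> {x. poly (p - q) x = 0}" by simp
  qed
  moreover have "infinite {-1..1::real}" by (simp add: infinite_Icc)
  ultimately have "p - q = 0" using poly_roots_finite finite_subset by blast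
  then show "p = q" by simp
qed

text \<open>\<open>F\<close> in \<open>\<real>[x][a]\<close>, with outer variable \<open>a\<close> and coefficients in \<open>\<real>[x]\<close>, represents the family
  \<open>f\<close> of polynomials in \<open>x\<close> when substituting any real \<open>a\<close> for the outer variable yields \<open>f a\<close>.
  Such an \<open>F\<close> is unique, since there are infinitely many values of \<open>a\<close>.\<close>

definition polynomial_in_parameter :: "(real \<Rightarrow> real poly) \<Rightarrow> real poly poly \<Rightarrow> bool" where
  "polynomial_in_parameter f F \<longleftrightarrow> (\<forall>a. poly F [:a:] = f a)"

lemma polynomial_in_parameter_unique:
  assumes "polynomial_in_parameter f F" "polynomial_in_parameter f G"
  shows "F = G"
proof -
  have "range (\<lambda>a::real. [:a:]) \<subseteq> {y. poly (F - G) y = 0}"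
    using assms by (auto simp: polynomial_in_parameter_def)
  moreover have "infinite (range (\<lambda>a::real. [:a:]))"
    by (simp add: finite_image_iff inj_on_def infinite_UNIV_char_0)
  ultimately have "F - G = 0" using poly_roots_finite finite_subset by blast
  then show ?thesis by simp
qed

end

theory Submission
  imports Defs
begin

text \<open>Comparing coefficients, the coefficient of \<open>x\<^sup>k\<^sup>+\<^sup>1\<close> in \<open>R\<^sub>n\<^sub>+\<^sub>1\<close> is
  \<open>(1 + a k / n) c\<^sub>k - (a / n) (k + 2) c\<^sub>k\<^sub>+\<^sub>2\<close>, where \<open>c\<^sub>j\<close> are the coefficients of \<open>R\<^sub>n\<close>. The degrees,
  dominant coefficients and signs follow from this by induction, since \<open>c\<^sub>k = 0\<close> for \<open>k > n\<close>.
  For \<open>a = 1\<close>, differentiating \<open>R\<^sub>n(cos t) = cos (n t)\<close> turns the recurrence into the addition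
  formula for \<open>cos ((n + 1) t)\<close>. As a polynomial in \<open>a\<close>, the coefficient of \<open>a\<^sup>n\<^sup>-\<^sup>1\<close> in \<open>R\<^sub>n\<close> is a monic
  polynomial of degree \<open>n\<close> in \<open>x\<close>, hence nonzero.\<close>

section \<open>Coefficient recurrence, degree bound and dominant coefficient\<close>

lemma coeff_Rpoly_Suc_0:
  "coeff (Rpoly a (Suc (Suc m))) 0 = - (a / real (Suc m)) * coeff (Rpoly a (Suc m)) 1"
  by (simp add: coeff_pderiv)

lemma coeff_Rpoly_Suc_Suc:
  "coeff (Rpoly a (Suc (Suc m))) (Suc k) =
     (1 + a * real k / real (Suc m)) * coeff (Rpoly a (Suc m)) k
     - a / real (Suc m) * real (k + 2) * coeff (Rpoly a (Suc m)) (k + 2)"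
proof -
  let ?R = "Rpoly a (Suc m)"
  have "coeff ([:1, 0, -1:] * pderiv ?R) (Suc k) = real (k + 2) * coeff ?R (k + 2) - real k * coeff ?R k"
    by (cases k) (simp_all add: coeff_pderiv)
  then have "coeff (Rpoly a (Suc (Suc m))) (Suc k) =
      coeff ?R k - a / real (Suc m) * (real (k + 2) * coeff ?R (k + 2) - real k * coeff ?R k)"
    by (simp only: Rpoly.simps(2) coeff_diff coeff_smult) simp
  then show ?thesis by (simp add: algebra_simps del: of_nat_Suc of_nat_add)
qed

declare Rpoly.simps(2) [simp del]

lemma coeff_Rpoly_above: "k > Suc m \<Longrightarrow> coeff (Rpoly a (Suc m)) k = 0"
proof (induction m arbitrary: k)
  case 0
  then show ?case by (auto simp: coeff_pCons split: nat.split)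
next
  case (Suc m)
  then obtain l where "k = Suc l" "l > Suc m" by (cases k) auto
  then show ?case using Suc.IH by (simp add: coeff_Rpoly_Suc_Suc)
qed

text \<open>At the top index the term with \<open>k + 2\<close> vanishes, and the remaining factor
  \<open>1 + a * k / n\<close> with \<open>k = n\<close> is \<open>a + 1\<close>.\<close>

lemma coeff_Rpoly_top: "coeff (Rpoly a (Suc m)) (Suc m) = (a + 1) ^ m"
proof (induction m)
  case (Suc m)
  then show ?case by (simp add: coeff_Rpoly_Suc_Suc coeff_Rpoly_above field_simps del: of_nat_Suc)
qed simp

section \<open>Parity and the values at 1 and -1\<close>

text \<open>Parity as an identity of polynomials can be differentiated: by the chain rule the
  derivative has the opposite parity. As x is odd and 1 - x^2 even, both terms of the recurrence
  then acquire the same sign.\<close>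

lemma pcompose_Rpoly_uminus:
  "pcompose (Rpoly a (Suc m)) [:0, -1:] = smult ((- 1) ^ Suc m) (Rpoly a (Suc m))"
proof (induction m)
  case 0
  then show ?case by (simp add: pcompose_pCons)
next
  case (Suc m)
  let ?R = "Rpoly a (Suc m)"
  have "pderiv (pcompose ?R [:0, -1:]) = - pcompose (pderiv ?R) [:0, -1:]"
    by (simp add: pderiv_pcompose pderiv_pCons)
  then have d: "pcompose (pderiv ?R) [:0, -1:] = smult ((- 1) ^ Suc (Suc m)) (pderiv ?R)"
    by (simp add: Suc pderiv_smult pderiv_minus)
  have x: "pcompose [:0, 1:] [:0, -1::real:] = - [:0, 1:]"
    "pcompose [:1, 0, -1:] [:0, -1::real:] = [:1, 0, -1:]"
    by (simp_all add: pcompose_pCons)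
  have c: "- p * smult ((- 1) ^ Suc m) r - smult b (q * smult ((- 1) ^ Suc (Suc m)) r')
      = smult ((- 1) ^ Suc (Suc m)) (p * r - smult b (q * r'))" for p q r r' :: "real poly" and b
    by (simp add: smult_diff_right mult.commute)
  show ?case
    by (simp only: Rpoly.simps(2) pcompose_diff pcompose_mult pcompose_smult x Suc d c)
qed

lemma poly_Rpoly_uminus:
  "poly (Rpoly a (Suc m)) (- x) = (- 1) ^ Suc m * poly (Rpoly a (Suc m)) x"
  using arg_cong[OF pcompose_Rpoly_uminus[of a m], of "\<lambda>p. poly p x"] by (simp add: poly_pcompose)

lemma poly_Rpoly_1: "poly (Rpoly a (Suc m)) 1 = 1"
  by (induction m) (auto simp: Rpoly.simps(2))

lemma Rpoly_0: "Rpoly 0 (Suc m) = [:0, 1:] ^ Suc m"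
  by (induction m) (auto simp: Rpoly.simps(2))

lemma poly_Rpoly_1_cos: "poly (Rpoly 1 (Suc m)) (cos t) = cos (real (Suc m) * t)"
proof (induction m arbitrary: t)
  case (Suc m)
  let ?R = "Rpoly 1 (Suc m)" and ?n = "real (Suc m)"
  have "((\<lambda>t. poly ?R (cos t)) has_real_derivative poly (pderiv ?R) (cos t) * - sin t) (at t)"
    by (rule DERIV_chain2[OF poly_DERIV]) (auto intro!: derivative_eq_intros)
  moreover have "((\<lambda>t. poly ?R (cos t)) has_real_derivative - sin (?n * t) * ?n) (at t)"
    unfolding Suc by (auto intro!: derivative_eq_intros)
  ultimately have "poly (pderiv ?R) (cos t) * sin t = sin (?n * t) * ?n"
    using DERIV_unique by fastforce
  \<comment> \<open>Multiplying by another \<open>sin t\<close> produces the factor 1 - x^2 of the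
    recurrence and avoids dividing by \<open>sin t\<close>, which may be zero.\<close>
  then have d: "(1 - cos t * cos t) * poly (pderiv ?R) (cos t) = ?n * (sin t * sin (?n * t))"
    using sin_squared_eq[of t, symmetric] by (simp only: power2_eq_square mult_ac)
  have "poly (Rpoly 1 (Suc (Suc m))) (cos t) =
      cos t * poly ?R (cos t) - (1 - cos t * cos t) * poly (pderiv ?R) (cos t) / ?n"
    by (simp add: Rpoly.simps(2)) (simp add: algebra_simps)
  also have "\<dots> = cos t * cos (?n * t) - sin t * sin (?n * t)"
    unfolding d Suc by simp
  also have "\<dots> = cos (t + ?n * t)" by (simp add: cos_add)
  also have "t + ?n * t = real (Suc (Suc m)) * t" by (simp add: algebra_simps)
  finally show ?case .
qed simp

lemma Rpoly_1_eq_chebyshev_T: "Rpoly 1 (Suc m) = chebyshev_T (Suc m)"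
  unfolding chebyshev_T_def
  by (rule the1_equality[OF chebyshev_T_unique_existence, symmetric]) (intro allI poly_Rpoly_1_cos)

section \<open>The degenerate case a = -1\<close>

text \<open>The drop in degree happens at the first step: x^2 + (1 - x^2) = 1. From there each step
  raises the degree bound by one.\<close>

lemma coeff_Rpoly_minus_1_above: "k > m \<Longrightarrow> coeff (Rpoly (- 1) (Suc (Suc m))) k = 0"
proof (induction m arbitrary: k)
  case 0
  moreover have "Rpoly (- 1) (Suc (Suc 0)) = 1"
    by (simp add: Rpoly.simps(2) pderiv_pCons one_pCons)
  ultimately show ?case by simp
next
  case (Suc m)
  then obtain l where l: "k = Suc l" "l > m" by (cases k) auto
  show ?case unfolding l(1) coeff_Rpoly_Suc_Suc using l(2) Suc.IH by simp
qed

lemma coeff_Rpoly_minus_1_top: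
  "coeff (Rpoly (- 1) (Suc (Suc m))) m = 2 ^ m / fact (Suc m)"
proof (induction m)
  case 0
  then show ?case by (simp add: Rpoly.simps(2) pderiv_pCons)
next
  case (Suc m)
  \<comment> \<open>This is the ratio of consecutive dominant coefficients; the product of these
    ratios is the claimed quotient.\<close>
  have "1 + - 1 * real m / real (Suc (Suc m)) = 2 / real (Suc (Suc m))"
    by (simp add: field_simps)
  then show ?case
    using Suc unfolding coeff_Rpoly_Suc_Suc
    by (simp add: coeff_Rpoly_minus_1_above del: of_nat_Suc)
qed

section \<open>Signs of the coefficients\<close>

text \<open>Passing from \<open>k\<close> to \<open>k + 2\<close> lowers \<open>j\<close> by one, so
  the factor \<open>(- 1) ^ j\<close> absorbs the minus sign of the recurrence and only positive
  terms are added.\<close>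

lemma coeff_Rpoly_alternating:
  assumes "a > 0"
  shows "2 * j \<le> Suc m \<Longrightarrow> (- 1) ^ j * coeff (Rpoly a (Suc m)) (Suc m - 2 * j) > 0"
proof (induction m arbitrary: j)
  case 0
  then have "j = 0" by simp
  then show ?case by simp
next
  case (Suc m)
  let ?c = "coeff (Rpoly a (Suc m))" and ?n = "real (Suc m)"
  \<comment> \<open>The cases are the dominant coefficient, the intermediate ones, and the constant
    term, for which the recurrence has a single summand.\<close>
  consider "j = 0" | i where "j = Suc i" "2 * j \<le> Suc m" | i where "j = Suc i" "2 * j = Suc (Suc m)"
    using Suc.prems by (cases j; cases "2 * j \<le> Suc m") auto
  then show ?case
  proof cases
    case 1
    then show ?thesis using assms coeff_Rpoly_top[of a "Suc m"] by simp
  next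
    case (2 i)
    define k where "k = Suc m - 2 * j"
    have k: "Suc (Suc m) - 2 * j = Suc k" "Suc m - 2 * i = k + 2" "2 * i \<le> Suc m"
      using 2 by (auto simp: k_def)
    have "(1 + a * real k / ?n) * ((- 1) ^ j * ?c k) > 0"
    proof (rule mult_pos_pos)
      show "1 + a * real k / ?n > 0" using assms by (intro add_pos_nonneg) auto
      show "(- 1) ^ j * ?c k > 0" using Suc.IH[OF 2(2)] by (simp add: k_def)
    qed
    moreover have "a / ?n * real (k + 2) * ((- 1) ^ i * ?c (k + 2)) > 0"
    proof (rule mult_pos_pos)
      show "a / ?n * real (k + 2) > 0" using assms by simp
      show "(- 1) ^ i * ?c (k + 2) > 0" using Suc.IH[OF k(3)] k(2) by simp
    qed
    ultimately show ?thesis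
      unfolding k(1) coeff_Rpoly_Suc_Suc by (simp add: 2(1) algebra_simps del: of_nat_Suc of_nat_add)
  next
    case (3 i)
    have i: "2 * i \<le> Suc m" "Suc m - 2 * i = 1" using 3 by auto
    have "a / ?n * ((- 1) ^ i * ?c 1) > 0"
    proof (rule mult_pos_pos)
      show "a / ?n > 0" using assms by simp
      show "(- 1) ^ i * ?c 1 > 0" using Suc.IH[OF i(1)] i(2) by simp
    qed
    then show ?thesis
      by (simp add: 3(2) coeff_Rpoly_Suc_0 del: of_nat_Suc) (simp add: 3(1) mult_ac del: of_nat_Suc)
  qed
qed

lemma coeff_Rpoly_nonneg:
  assumes "- 1 \<le> a" "a \<le> 0"
  shows "coeff (Rpoly a (Suc m)) k \<ge> 0"
proof (induction m arbitrary: k)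
  case 0
  then show ?case by (auto simp: coeff_pCons split: nat.split)
next
  case (Suc m)
  let ?c = "coeff (Rpoly a (Suc m))" and ?n = "real (Suc m)"
  have neg: "- (a / ?n) \<ge> 0" using assms by (simp add: divide_nonpos_pos)
  show ?case
  proof (cases k)
    case 0
    show ?thesis unfolding 0 coeff_Rpoly_Suc_0 by (rule mult_nonneg_nonneg[OF neg Suc])
  next
    case (Suc l)
    have "(1 + a * real l / ?n) * ?c l \<ge> 0"
    \<comment> \<open>For \<open>l\<close> above the degree bound the first factor may be negative,
      but then the coefficient is zero.\<close>
    proof (cases "l \<le> Suc m")
      case True
      have "- a * real l \<le> 1 * ?n" using assms True by (intro mult_mono) auto
      then have "1 + a * real l / ?n \<ge> 0" by (simp add: field_simps)
      then show ?thesis using Suc.IH by (rule mult_nonneg_nonneg)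
    qed (simp add: coeff_Rpoly_above)
    moreover have "- (a / ?n) * real (l + 2) * ?c (l + 2) \<ge> 0"
      using neg Suc.IH by (intro mult_nonneg_nonneg) auto
    ultimately show ?thesis unfolding Suc coeff_Rpoly_Suc_Suc by linarith
  qed
qed

section \<open>Dependence on the parameter a\<close>

lemma poly_map_poly_pderiv:
  fixes F :: "'a :: {comm_semiring_1, semiring_no_zero_divisors} poly poly"
  shows "poly (map_poly pderiv F) [:a:] = pderiv (poly F [:a:])"
  by (induction F) (auto simp: map_poly_pCons pderiv_add pderiv_smult pderiv_pCons)

text \<open>The recurrence lifted to polynomials in a over \<real>[x], with index shifted by one:
  \<open>pCons 0\<close> multiplies by a, and \<open>map_poly pderiv\<close> differentiates in
  x.\<close>

fun Rbipoly :: "nat \<Rightarrow> real poly poly" where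
  "Rbipoly 0 = [:[:0, 1:]:]"
| "Rbipoly (Suc m) = smult [:0, 1:] (Rbipoly m)
     - pCons 0 (smult (smult (1 / real (Suc m)) [:1, 0, -1:]) (map_poly pderiv (Rbipoly m)))"

lemma polynomial_in_parameter_Rbipoly:
  "polynomial_in_parameter (\<lambda>a. Rpoly a (Suc m)) (Rbipoly m)"
  unfolding polynomial_in_parameter_def
proof (induction m)
  case (Suc m)
  show ?case
  proof
    fix a
    have "smult (a / real (Suc m)) p = [:a:] * smult (1 / real (Suc m)) p" for p :: "real poly"
      by simp
    then show "poly (Rbipoly (Suc m)) [:a:] = Rpoly a (Suc (Suc m))"
      unfolding Rbipoly.simps Rpoly.simps(2) using Suc
      by (simp only: poly_diff poly_smult poly_pCons poly_map_poly_pderiv mult_smult_left)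
  qed
qed simp

lemma coeff_Rbipoly_above: "k > m \<Longrightarrow> coeff (Rbipoly m) k = 0"
proof (induction m arbitrary: k)
  case 0
  then show ?case by (simp add: coeff_pCons split: nat.split)
next
  case (Suc m)
  then obtain l where "k = Suc l" "l > m" by (cases k) auto
  then show ?case using Suc.IH by (simp add: coeff_map_poly)
qed

text \<open>Only the derivative term raises the degree in a, so the top coefficients satisfy a
  recurrence of their own.\<close>

lemma coeff_Rbipoly_top:
  "coeff (Rbipoly (Suc m)) (Suc m) =
     - smult (1 / real (Suc m)) ([:1, 0, -1:] * pderiv (coeff (Rbipoly m) m))"
  by (simp add: coeff_Rbipoly_above coeff_map_poly del: mult_pCons_left smult_pCons)

lemma coeff_Rbipoly_top_above: "k > Suc m \<Longrightarrow> coeff (coeff (Rbipoly m) m) k = 0"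
proof (induction m arbitrary: k)
  case 0
  then show ?case by (auto simp: coeff_pCons split: nat.split)
next
  case (Suc m)
  then obtain l where "k = Suc (Suc l)" "l > m"
    by (metis Suc_less_eq2)
  then show ?case using Suc.IH unfolding coeff_Rbipoly_top by (simp add: coeff_pderiv)
qed

text \<open>The operator sending p to (x^2 - 1) p' / (m + 1) maps x^(m+1) to x^(m+2) - x^m, so the
  coefficient stays monic.\<close>

lemma coeff_Rbipoly_top_top: "coeff (coeff (Rbipoly m) m) (Suc m) = 1"
proof (induction m)
  case (Suc m)
  then show ?case unfolding coeff_Rbipoly_top
    by (simp add: coeff_pderiv coeff_Rbipoly_top_above del: of_nat_Suc)
qed simp

lemma degree_Rbipoly: "degree (Rbipoly m) = m"
proof (rule antisym)
  show "degree (Rbipoly m) \<le> m" by (intro degree_le) (simp add: coeff_Rbipoly_above)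
  have "coeff (Rbipoly m) m \<noteq> 0" using coeff_Rbipoly_top_top[of m] by auto
  then show "m \<le> degree (Rbipoly m)" by (rule le_degree)
qed

lemma degree_eqI:
  assumes "\<And>k. k > n \<Longrightarrow> coeff p k = 0" "coeff p n \<noteq> 0"
  shows "degree p = n"
  by (rule antisym) (use assms in \<open>auto intro: degree_le le_degree\<close>)

theorem lemma5:
  shows
   "(\<forall>a::real. \<forall>n\<ge>1.
       (odd n \<longrightarrow> (\<forall>x. poly (Rpoly a n) (- x) = - poly (Rpoly a n) x)) \<and>
       (even n \<longrightarrow> (\<forall>x. poly (Rpoly a n) (- x) = poly (Rpoly a n) x)) \<and>
       poly (Rpoly a n) 1 = 1 \<and> poly (Rpoly a n) (- 1) = (- 1) ^ n) \<and>
    (\<forall>a::real. a \<noteq> - 1 \<longrightarrow> (\<forall>n\<ge>1.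
       degree (Rpoly a n) = n \<and> lead_coeff (Rpoly a n) = (a + 1) ^ (n - 1))) \<and>
    (\<forall>n\<ge>1. Rpoly 0 n = [:0, 1:] ^ n) \<and>
    (\<forall>n\<ge>1. Rpoly 1 n = chebyshev_T n) \<and>
    (Rpoly (- 1) 1 = [:0, 1:] \<and>
     (\<forall>n\<ge>2. degree (Rpoly (- 1) n) = n - 2 \<and>
             lead_coeff (Rpoly (- 1) n) = 2 ^ (n - 2) / fact (n - 1))) \<and>
    ((\<forall>a::real. a > 0 \<longrightarrow> (\<forall>n\<ge>1. \<forall>j. 2 * (j + 1) \<le> n \<longrightarrow>
        coeff (Rpoly a n) (n - 2 * j) * coeff (Rpoly a n) (n - 2 * (j + 1)) < 0)) \<and>
     (\<forall>a\<in>{-1..0}. \<forall>n\<ge>1. \<forall>k. coeff (Rpoly a n) k \<ge> 0)) \<and>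
    (\<forall>n\<ge>1. \<exists>F. polynomial_in_parameter (\<lambda>a. Rpoly a n) F \<and> degree F = n - 1)"
proof (intro conjI allI ballI impI)
  fix a :: real and n :: nat assume "n \<ge> 1"
  then obtain m where n: "n = Suc m" by (cases n) auto
  show "poly (Rpoly a n) (- x) = - poly (Rpoly a n) x" if "odd n" for x
    using that poly_Rpoly_uminus[of a m x] by (simp add: n)
  show "poly (Rpoly a n) (- x) = poly (Rpoly a n) x" if "even n" for x
    using that poly_Rpoly_uminus[of a m x] by (simp add: n)
  show "poly (Rpoly a n) 1 = 1" by (simp add: n poly_Rpoly_1)
  show "poly (Rpoly a n) (- 1) = (- 1) ^ n"
    using poly_Rpoly_uminus[of a m 1] by (simp add: n poly_Rpoly_1)
  {
    assume "a \<noteq> - 1"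
    then have "a + 1 \<noteq> 0" by linarith
    then show deg: "degree (Rpoly a n) = n"
      unfolding n by (intro degree_eqI) (simp_all add: coeff_Rpoly_above coeff_Rpoly_top)
    show "lead_coeff (Rpoly a n) = (a + 1) ^ (n - 1)"
      by (simp add: deg) (simp add: n coeff_Rpoly_top)
  }
  show "coeff (Rpoly a n) (n - 2 * j) * coeff (Rpoly a n) (n - 2 * (j + 1)) < 0"
    if "a > 0" "2 * (j + 1) \<le> n" for j
  proof -
    let ?u = "coeff (Rpoly a n) (n - 2 * j)" and ?v = "coeff (Rpoly a n) (n - 2 * (j + 1))"
    have "(- 1) ^ j * ?u > 0" "(- 1) ^ (j + 1) * ?v > 0"
      using that coeff_Rpoly_alternating[of a j m] coeff_Rpoly_alternating[of a "j + 1" m]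
      by (simp_all add: n)
    then show ?thesis by (cases "even j") (auto simp: mult_less_0_iff)
  qed
  show "coeff (Rpoly a n) k \<ge> 0" if "a \<in> {-1..0}" for k
    using that coeff_Rpoly_nonneg by (simp add: n)
next
  fix n :: nat assume "n \<ge> 1"
  then obtain m where n: "n = Suc m" by (cases n) auto
  show "Rpoly 0 n = [:0, 1:] ^ n" unfolding n by (rule Rpoly_0)
  show "Rpoly 1 n = chebyshev_T n" unfolding n by (rule Rpoly_1_eq_chebyshev_T)
  show "\<exists>F. polynomial_in_parameter (\<lambda>a. Rpoly a n) F \<and> degree F = n - 1"
    using polynomial_in_parameter_Rbipoly[of m] degree_Rbipoly[of m] by (auto simp: n)
next
  show "Rpoly (- 1) 1 = [:0, 1:]" by simp
next
  fix n :: nat assume "n \<ge> 2"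
  then obtain m where n: "n = Suc (Suc m)" by (metis add_2_eq_Suc le_Suc_ex)
  show deg: "degree (Rpoly (- 1) n) = n - 2"
    unfolding n
    by (intro degree_eqI) (simp_all add: coeff_Rpoly_minus_1_above coeff_Rpoly_minus_1_top)
  show "lead_coeff (Rpoly (- 1) n) = 2 ^ (n - 2) / fact (n - 1)"
    unfolding deg by (simp add: n coeff_Rpoly_minus_1_top)
qed

end
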